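(* Let $A,B\in\mathbb{P}(2n)$. Then $$\max_{1\le j\le n}|d_j(A)-d_j(B)|\le K(A,B)\,\|A-B\|,$$ where $K(A,B)=\int_{0}^{1}\kappa(A+t(B-A))\,dt$.
   Context: Let $J=\begin{bmatrix}O & I_n\\ -I_n & O\end{bmatrix}$ ($2n\times 2n$). A real $2n\times 2n$ matrix $M$ is symplectic if $M^TJM=J$. $\mathbb{P}(2n)$ denotes the set of $2n\times 2n$ real symmetric positive definite matrices. By Williamson's theorem, for every $A\in\mathbb{P}(2n)$ there is a symplectic $M$ with $M^TAM=\begin{bmatrix}D&O\\O&D\end{bmatrix}$, $D=\mathrm{diag}(d_1(A),\dots,d_n(A))$, where $0<d_1(A)\le\dots\le d_n(A)$ are uniquely determined by $A$; they are the symplectic eigenvalues of $A$, always listed in increasing order. $\|\cdot\|$ is the operator norm induced by the Euclidean norm, and $\kappa(A)=\|A\|\,\|A^{-1}\|$ is the condition number. *)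

theory Defs
  imports "HOL-Analysis.Analysis"
begin

text \<open>
  The index type \<open>'n\<close> plays the role of the ordered set \<open>{1, \<dots>, n}\<close>, and
  \<open>'n + 'n\<close> that of \<open>{1, \<dots>, 2n}\<close>: \<open>Inl\<close> indexes the first block
  of coordinates and \<open>Inr\<close> the second one.
\<close>

definition block_matrix ::
  "'a^'n^'n \<Rightarrow> 'a^'n^'n \<Rightarrow> 'a^'n^'n \<Rightarrow> 'a^'n^'n \<Rightarrow> 'a^('n + 'n)^('n + 'n)" where
  "block_matrix P Q R S = (\<chi> i j. case i of
      Inl a \<Rightarrow> (case j of Inl b \<Rightarrow> P $ a $ b | Inr b \<Rightarrow> Q $ a $ b)
    | Inr a \<Rightarrow> (case j of Inl b \<Rightarrow> R $ a $ b | Inr b \<Rightarrow> S $ a $ b))"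

definition diag_matrix :: "('n \<Rightarrow> 'a::zero) \<Rightarrow> 'a^'n^'n" where
  "diag_matrix d = (\<chi> i j. if i = j then d i else 0)"

definition symplectic_J :: "real^('n::finite + 'n)^('n + 'n)" where
  "symplectic_J = block_matrix 0 (mat 1) (- mat 1) 0"

definition symplectic :: "real^('n::finite + 'n)^('n + 'n) \<Rightarrow> bool" where
  "symplectic M \<longleftrightarrow> transpose M ** symplectic_J ** M = symplectic_J"

definition pos_def_matrices :: "(real^'m^'m) set" where
  "pos_def_matrices = {A. transpose A = A \<and> (\<forall>x. x \<noteq> 0 \<longrightarrow> 0 < x \<bullet> (A *v x))}"

definition williamson_form ::
  "real^('n::{finite,linorder} + 'n)^('n + 'n) \<Rightarrow> ('n \<Rightarrow> real) \<Rightarrow> bool" where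
  "williamson_form A d \<longleftrightarrow> (\<forall>j. 0 < d j) \<and> mono d \<and>
     (\<exists>M. symplectic M \<and>
        transpose M ** A ** M = block_matrix (diag_matrix d) 0 0 (diag_matrix d))"

text \<open>
  For \<open>A\<close> positive definite, Williamson's theorem says that exactly one \<open>d\<close>
  satisfies \<open>williamson_form A d\<close>; outside that case the value is unspecified.
\<close>

definition symplectic_eigenvalue ::
  "real^('n::{finite,linorder} + 'n)^('n + 'n) \<Rightarrow> 'n \<Rightarrow> real" where
  "symplectic_eigenvalue A = (THE d. williamson_form A d)"

definition op_norm :: "real^'m^'m \<Rightarrow> real" where
  "op_norm A = onorm ((*v) A)"

definition condition_number :: "real^'m^'m \<Rightarrow> real" where
  "condition_number A = op_norm A * op_norm (matrix_inv A)"

end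

theory Submission
  imports Defs
begin

text \<open>
  Symplectic eigenvalues are monotone in the Loewner order, by a dimension count in the style of
  Courant and Fischer, and positively homogeneous. Hence a perturbation of size \<open>\<delta>\<close>, which is
  bounded above by \<open>\<delta> \<parallel>A\<^sup>-\<^sup>1\<parallel> A\<close>, increases \<open>d\<^sub>j(A) \<le> \<parallel>A\<parallel>\<close> by at most \<open>\<kappa>(A) \<delta>\<close>. This
  one-sided local estimate integrates along the segment from \<open>A\<close> to \<open>B\<close>, so that no
  differentiability of \<open>d\<^sub>j\<close> is needed.
\<close>

text \<open>Since \<open>symplectic_eigenvalue\<close> is a definite description, nothing can be
  said about it before existence and uniqueness of the Williamson form are known. Monotonicity is
  therefore stated for arbitrary Williamson forms: taken with both matrices equal, it also gives
  uniqueness, so only existence needs a separate construction.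

  The local estimate is not symmetric. It bounds the increase from A to B by the condition number at
  the starting point A, while a decrease is controlled by the condition number at B. The absolute
  value is reached by traversing the segment in both directions; reflection of [0,1] shows that the
  two integrals agree.\<close>

section \<open>Congruences and the symplectic form in block coordinates\<close>

lemma sum_UNIV_Plus:
  "sum f (UNIV :: ('a::finite + 'b::finite) set) = (\<Sum>i\<in>UNIV. f (Inl i)) + (\<Sum>i\<in>UNIV. f (Inr i))"
  by (simp add: UNIV_Plus_UNIV[symmetric] sum.Plus del: UNIV_Plus_UNIV)

lemma inner_congruence:
  fixes A M :: "real^'m^'m"
  shows "(M *v x) \<bullet> (A *v (M *v y)) = x \<bullet> ((transpose M ** A ** M) *v y)"
  by (metis dot_lmul_matrix matrix_vector_mul_assoc transpose_matrix_vector transpose_transpose)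

text \<open>Turns matrix identities for a congruence into relations between columns, so that a
  symplectic diagonalizing matrix can be assembled from vectors.\<close>

lemma congruence_component:
  fixes A M :: "real^'m^'m"
  shows "(transpose M ** A ** M) $ i $ j = column i M \<bullet> (A *v column j M)"
proof -
  have "(transpose M ** A ** M) $ i $ j = axis i 1 \<bullet> ((transpose M ** A ** M) *v axis j 1)"
    unfolding matrix_vector_mult_basis by (simp add: inner_axis' column_def)
  also have "\<dots> = column i M \<bullet> (A *v column j M)"
    by (metis inner_congruence matrix_vector_mult_basis)
  finally show ?thesis .
qed

lemma symplectic_J_mult_Inl [simp]: "(symplectic_J *v x) $ Inl i = x $ Inr i"
  by (simp add: matrix_vector_mult_def symplectic_J_def block_matrix_def sum_UNIV_Plus mat_def
      if_distrib[of "\<lambda>x. x * _"] cong: if_cong)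

lemma symplectic_J_mult_Inr [simp]: "(symplectic_J *v x) $ Inr i = - x $ Inl i"
  by (simp add: matrix_vector_mult_def symplectic_J_def block_matrix_def sum_UNIV_Plus mat_def
      if_distrib[of "\<lambda>x. - x * _"] if_distrib[of "\<lambda>x. x * _"] if_distrib[of "\<lambda>x. - x"] cong: if_cong)

lemma inner_symplectic_J:
  "x \<bullet> (symplectic_J *v y) = (\<Sum>i\<in>UNIV. x $ Inl i * y $ Inr i - x $ Inr i * y $ Inl i)"
  by (simp add: inner_vec_def sum_UNIV_Plus sum_subtractf sum_negf)

lemma inner_symplectic_J_swap: "x \<bullet> (symplectic_J *v y) = - (y \<bullet> (symplectic_J *v x))"
  by (simp add: inner_symplectic_J sum_negf[symmetric] algebra_simps)

lemma inner_symplectic_J_self [simp]: "x \<bullet> (symplectic_J *v x) = 0"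
  using inner_symplectic_J_swap[of x x] by simp

lemma symplectic_J_involution: "symplectic_J *v (symplectic_J *v x) = - x"
proof -
  have "(symplectic_J *v (symplectic_J *v x)) $ k = (- x) $ k" for k
    by (cases k) auto
  then show ?thesis by (simp add: vec_eq_iff)
qed

lemma symplectic_J_mult_eq_0_iff [simp]: "symplectic_J *v x = 0 \<longleftrightarrow> x = 0"
  by (metis matrix_vector_mult_0_right neg_equal_0_iff_equal symplectic_J_involution)

lemma inner_block_diag:
  "x \<bullet> (block_matrix (diag_matrix d) 0 0 (diag_matrix d) *v x) =
    (\<Sum>i\<in>UNIV. (d i :: real) * ((x $ Inl i)\<^sup>2 + (x $ Inr i)\<^sup>2))"
proof -
  have "(block_matrix (diag_matrix d) 0 0 (diag_matrix d) *v x) $ Inl i = d i * x $ Inl i"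
       "(block_matrix (diag_matrix d) 0 0 (diag_matrix d) *v x) $ Inr i = d i * x $ Inr i" for i
    by (simp_all add: matrix_vector_mult_def block_matrix_def diag_matrix_def sum_UNIV_Plus
      if_distrib[of "\<lambda>x. x * _"] cong: if_cong)
  then show ?thesis
    by (simp add: inner_vec_def sum_UNIV_Plus sum.distrib[symmetric] power2_eq_square algebra_simps)
qed

lemma matrix_inv_left: "invertible A \<Longrightarrow> matrix_inv A ** A = mat 1"
  and matrix_inv_right: "invertible A \<Longrightarrow> A ** matrix_inv A = mat 1"
  unfolding invertible_def matrix_inv_def by (rule someI2_ex; blast)+

lemma symplectic_invertible:
  assumes "symplectic M"
  shows "invertible M"
proof -
  have "x = 0" if "M *v x = 0" for x
  proof -
    have "symplectic_J *v x = (transpose M ** symplectic_J ** M) *v x"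
      using assms by (simp add: symplectic_def)
    also have "\<dots> = 0"
      by (simp add: matrix_vector_mul_assoc[symmetric] that)
    finally show ?thesis by simp
  qed
  then show ?thesis
    by (meson invertible_left_inverse matrix_left_invertible_ker)
qed

lemma inner_symplectic_image:
  assumes "symplectic M"
  shows "(M *v x) \<bullet> (symplectic_J *v (M *v y)) = x \<bullet> (symplectic_J *v y)"
  using assms by (simp add: inner_congruence symplectic_def)

section \<open>Monotonicity of symplectic eigenvalues\<close>

lemma dim_image_supported:
  fixes M :: "real^'m^'m"
  assumes "invertible M"
  shows "dim ((*v) M ` {x. \<forall>k. k \<notin> S \<longrightarrow> x $ k = 0}) = card S"
proof -
  have "inj ((*v) M)"
    using assms by (simp add: inj_matrix_vector_mult)
  then have "dim ((*v) M ` {x. \<forall>k. k \<notin> S \<longrightarrow> x $ k = 0}) = dim {x::real^'m. \<forall>k. k \<notin> S \<longrightarrow> x $ k = 0}"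
    by (intro dim_image_eq) (auto intro: inj_on_subset)
  also have "\<dots> = card S"
    using dim_substandard_cart[of S, where ?'a = real] by (simp only: dim_vec_eq)
  finally show ?thesis .
qed

text \<open>By the dimension formula, two subspaces whose dimensions add up to more than that of the
  space share a nonzero vector. The result is phrased in coordinates because the supports of both
  preimages are what the energy comparison needs.\<close>

lemma supported_images_meet:
  fixes M N :: "real^'m^'m"
  assumes "invertible M" "invertible N" "CARD('m) < card S + card T"
  obtains x y where "x \<noteq> 0" "M *v x = N *v y"
    "\<And>k. k \<notin> S \<Longrightarrow> x $ k = 0" "\<And>k. k \<notin> T \<Longrightarrow> y $ k = 0"
proof -
  define V where "V = (*v) M ` {x. \<forall>k. k \<notin> S \<longrightarrow> x $ k = 0}"
  define W where "W = (*v) N ` {x. \<forall>k. k \<notin> T \<longrightarrow> x $ k = 0}"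
  have sub: "subspace {x::real^'m. \<forall>k. k \<notin> U \<longrightarrow> x $ k = 0}" for U
    by (auto simp: subspace_def)
  have "subspace V" "subspace W"
    unfolding V_def W_def by (intro linear_subspace_image sub matrix_vector_mul_linear)+
  then have "dim {x + y |x y. x \<in> V \<and> y \<in> W} + dim (V \<inter> W) = card S + card T"
    using assms by (simp add: dim_sums_Int V_def W_def dim_image_supported)
  moreover have "dim {x + y |x y. x \<in> V \<and> y \<in> W} \<le> CARD('m)"
    using dim_subset_UNIV_cart by blast
  ultimately have "dim (V \<inter> W) \<noteq> 0"
    using assms(3) by linarith
  then obtain z where "z \<in> V" "z \<in> W" "z \<noteq> 0"
    by (auto simp: dim_eq_0)
  then show thesis
    using that unfolding V_def W_def by (auto simp: image_iff) (metis matrix_vector_mult_0_right)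
qed

text \<open>
  A common vector of the span of the first \<open>j\<close> symplectic pairs for \<open>B\<close> and of the last
  \<open>n - j + 1\<close> pairs for \<open>A\<close> has to exist for dimensional reasons; comparing the symplectic form
  with both energies on it, and on its conjugate vector, gives the inequality.
\<close>

lemma williamson_form_mono:
  fixes A B :: "real^('n::{finite,linorder} + 'n)^('n + 'n)"
  assumes A: "williamson_form A d" and B: "williamson_form B e"
    and le: "\<And>x. x \<bullet> (A *v x) \<le> x \<bullet> (B *v x)"
  shows "d j \<le> e j"
proof -
  obtain M where M: "symplectic M"
      "transpose M ** A ** M = block_matrix (diag_matrix d) 0 0 (diag_matrix d)"
    using A by (auto simp: williamson_form_def)
  obtain N where N: "symplectic N"
      "transpose N ** B ** N = block_matrix (diag_matrix e) 0 0 (diag_matrix e)"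
    using B by (auto simp: williamson_form_def)
  have pos: "0 < d i" "0 < e i" and mono: "mono d" "mono e" for i
    using A B by (auto simp: williamson_form_def)
  \<comment> \<open>The two index ranges overlap exactly in \<open>j\<close>, so their sizes add up
    to n + 1. Doubled over both blocks this is 2n + 2, which exceeds 2n.\<close>
  have "card {..j} + card {j..} = card ({..j} \<union> {j..}) + card ({..j} \<inter> {j..})"
    by (intro card_Un_Int) auto
  also have "{..j} \<union> {j..} = UNIV" by auto
  also have "{..j} \<inter> {j..} = {j}" by auto
  finally have "CARD('n + 'n) < card ({..j} <+> {..j}) + card ({j..} <+> {j..})"
    by (simp add: card_Plus)
  then obtain x a where x: "x \<noteq> 0" "N *v x = M *v a"
      "\<And>k. k \<notin> {..j} <+> {..j} \<Longrightarrow> x $ k = 0" "\<And>k. k \<notin> {j..} <+> {j..} \<Longrightarrow> a $ k = 0"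
    using supported_images_meet symplectic_invertible M(1) N(1) by metis
  have x0: "x $ Inl i = 0" "x $ Inr i = 0" if "j < i" for i
    using that x(3) by (auto simp: not_le[symmetric] Plus_def)
  have a0: "a $ Inl i = 0" "a $ Inr i = 0" if "i < j" for i
    using that x(4) by (auto simp: not_le[symmetric] Plus_def)
  \<comment> \<open>This conjugate vector makes the symplectic form of \<open>x\<close> and
    \<open>y\<close> equal to \<open>x \<bullet> x\<close>, and it has the same size as
    \<open>x\<close> in every coordinate pair, hence the same B-energy. Its coordinates
    \<open>b\<close> with respect to \<open>M\<close> need not vanish below \<open>j\<close>; the
    support of \<open>a\<close> alone suffices, because each term of the symplectic form contains a
    coordinate of \<open>a\<close>.\<close>
  define y where "y = - (symplectic_J *v x)"
  define b where "b = matrix_inv M *v (N *v y)"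
  have b: "M *v b = N *v y"
    unfolding b_def using symplectic_invertible[OF M(1)]
    by (simp add: matrix_vector_mul_assoc[of M "matrix_inv M"] matrix_inv_right)
  have y: "y $ Inl i = - x $ Inr i" "y $ Inr i = x $ Inl i" for i
    by (simp_all add: y_def)
  define w where "w = (\<Sum>i\<in>UNIV. (x $ Inl i)\<^sup>2 + (x $ Inr i)\<^sup>2)"
  have "w = x \<bullet> x"
    by (simp add: w_def inner_vec_def sum_UNIV_Plus sum.distrib power2_eq_square)
  with x(1) have "0 < w" by simp
  have "x \<bullet> (symplectic_J *v y) = w"
    by (simp add: inner_symplectic_J y w_def power2_eq_square)
  then have w: "a \<bullet> (symplectic_J *v b) = w"
    by (metis M(1) N(1) b inner_symplectic_image x(2))
  \<comment> \<open>Below \<open>j\<close> the left side vanishes with \<open>a\<close>. From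
    \<open>j\<close> on, the inequality between a product and a sum of squares applies, and
    \<open>d j\<close> may be enlarged to \<open>d i\<close>.\<close>
  have "2 * d j * (a $ Inl i * b $ Inr i - a $ Inr i * b $ Inl i)
      \<le> d i * ((a $ Inl i)\<^sup>2 + (a $ Inr i)\<^sup>2) + d i * ((b $ Inl i)\<^sup>2 + (b $ Inr i)\<^sup>2)" for i
  proof (cases "i < j")
    case True
    then show ?thesis using pos(1)[of i] by (simp add: a0)
  next
    case False
    let ?s = "(a $ Inl i)\<^sup>2 + (a $ Inr i)\<^sup>2 + (b $ Inl i)\<^sup>2 + (b $ Inr i)\<^sup>2"
    have "0 \<le> (a $ Inl i - b $ Inr i)\<^sup>2 + (a $ Inr i + b $ Inl i)\<^sup>2" by simp
    then have "2 * (a $ Inl i * b $ Inr i - a $ Inr i * b $ Inl i) \<le> ?s"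
      by (simp add: power2_eq_square algebra_simps)
    then have "d j * (2 * (a $ Inl i * b $ Inr i - a $ Inr i * b $ Inl i)) \<le> d j * ?s"
      using pos(1)[of j] by (intro mult_left_mono) auto
    also have "d j * ?s \<le> d i * ?s"
      using False mono(1) by (intro mult_right_mono) (auto simp: mono_def)
    finally show ?thesis by (simp add: algebra_simps)
  qed
  then have "2 * d j * w \<le> (\<Sum>i\<in>UNIV. d i * ((a $ Inl i)\<^sup>2 + (a $ Inr i)\<^sup>2))
      + (\<Sum>i\<in>UNIV. d i * ((b $ Inl i)\<^sup>2 + (b $ Inr i)\<^sup>2))"
    unfolding w[symmetric] inner_symplectic_J sum_distrib_left sum.distrib[symmetric]
    by (intro sum_mono) auto
  also have "\<dots> = (M *v a) \<bullet> (A *v (M *v a)) + (M *v b) \<bullet> (A *v (M *v b))"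
    by (simp add: inner_congruence M(2) inner_block_diag)
  also have "\<dots> \<le> (N *v x) \<bullet> (B *v (N *v x)) + (N *v y) \<bullet> (B *v (N *v y))"
    unfolding b x(2)[symmetric] by (intro add_mono le)
  also have "\<dots> = 2 * (\<Sum>i\<in>UNIV. e i * ((x $ Inl i)\<^sup>2 + (x $ Inr i)\<^sup>2))"
    by (simp add: inner_congruence N(2) inner_block_diag y add.commute)
  also have "(\<Sum>i\<in>UNIV. e i * ((x $ Inl i)\<^sup>2 + (x $ Inr i)\<^sup>2)) \<le> e j * w"
    unfolding w_def sum_distrib_left
  proof (rule sum_mono)
    fix i
    show "e i * ((x $ Inl i)\<^sup>2 + (x $ Inr i)\<^sup>2) \<le> e j * ((x $ Inl i)\<^sup>2 + (x $ Inr i)\<^sup>2)"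
      using mono(2) by (cases "j < i") (auto simp: x0 mono_def intro!: mult_right_mono)
  qed
  finally show ?thesis using \<open>0 < w\<close> by simp
qed

section \<open>Positive definite matrices\<close>

lemma pos_def_inner_swap:
  assumes "A \<in> pos_def_matrices"
  shows "x \<bullet> (A *v y) = y \<bullet> (A *v x)"
  using assms unfolding pos_def_matrices_def
  by (metis (mono_tags, lifting) dot_lmul_matrix inner_commute mem_Collect_eq transpose_matrix_vector)

lemma pos_def_pos: "A \<in> pos_def_matrices \<Longrightarrow> x \<noteq> 0 \<Longrightarrow> 0 < x \<bullet> (A *v x)"
  by (simp add: pos_def_matrices_def)

lemma pos_def_nonneg: "A \<in> pos_def_matrices \<Longrightarrow> 0 \<le> x \<bullet> (A *v x)"
  by (cases "x = 0") (auto dest: pos_def_pos[of _ x])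

lemma pos_def_invertible:
  assumes "A \<in> pos_def_matrices"
  shows "invertible A"
proof -
  have "x = 0" if "A *v x = 0" for x
    using pos_def_pos[OF assms, of x] that by fastforce
  then show ?thesis
    by (meson invertible_left_inverse matrix_left_invertible_ker)
qed

lemma pos_def_mult_inv:
  assumes "A \<in> pos_def_matrices"
  shows "A *v (matrix_inv A *v x) = x" "matrix_inv A *v (A *v x) = x"
  using pos_def_invertible[OF assms]
  by (simp_all add: matrix_vector_mul_assoc matrix_inv_right matrix_inv_left)

lemma matrix_inv_pos_def:
  assumes A: "A \<in> pos_def_matrices"
  shows "matrix_inv A \<in> pos_def_matrices"
proof -
  have "transpose A = A" using A by (simp add: pos_def_matrices_def)
  then have "transpose (matrix_inv A) ** A = mat 1"
    by (metis A matrix_inv_right matrix_transpose_mul pos_def_invertible transpose_mat)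
  then have "transpose (matrix_inv A) = matrix_inv A"
    by (metis A matrix_inv_right matrix_mul_assoc matrix_mul_lid matrix_mul_rid pos_def_invertible)
  moreover have "0 < x \<bullet> (matrix_inv A *v x)" if "x \<noteq> 0" for x
  proof -
    have "matrix_inv A *v x \<noteq> 0"
      using that pos_def_mult_inv(1)[OF A, of x] by auto
    then show ?thesis
      using pos_def_pos[OF A] pos_def_mult_inv(1)[OF A, of x] by (metis inner_commute)
  qed
  ultimately show ?thesis by (simp add: pos_def_matrices_def)
qed

lemma norm_mult_le_op_norm: "norm (A *v x) \<le> op_norm A * norm x"
  unfolding op_norm_def by (intro onorm matrix_vector_mul_bounded_linear)

lemma op_norm_nonneg: "0 \<le> op_norm A"
  unfolding op_norm_def by (intro onorm_pos_le matrix_vector_mul_bounded_linear)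

lemma inner_mult_le_op_norm: "x \<bullet> (A *v x) \<le> op_norm A * (x \<bullet> x)"
proof -
  have "x \<bullet> (A *v x) \<le> norm x * norm (A *v x)" by (rule norm_cauchy_schwarz)
  also have "\<dots> \<le> norm x * (op_norm A * norm x)"
    by (intro mult_left_mono norm_mult_le_op_norm) simp
  finally show ?thesis by (simp add: dot_square_norm power2_eq_square ac_simps)
qed

lemma op_norm_le: "0 \<le> c \<Longrightarrow> (\<And>x. norm (A *v x) \<le> c * norm x) \<Longrightarrow> op_norm A \<le> c"
  unfolding op_norm_def by (rule onorm_le)

lemma op_norm_diff_commute: "op_norm (A - B) = op_norm (B - A)"
proof -
  have "(*v) (A - B) = (\<lambda>x. - ((B - A) *v x))"
    by (auto simp: matrix_vector_mult_diff_rdistrib)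
  then show ?thesis by (simp add: op_norm_def onorm_neg)
qed

lemma op_norm_scaleR: "op_norm (c *\<^sub>R A) = \<bar>c\<bar> * op_norm A"
  unfolding op_norm_def scaleR_matrix_vector_assoc[symmetric]
  by (intro onorm_scaleR matrix_vector_mul_bounded_linear)

lemma op_norm_triangle: "op_norm (A + B) \<le> op_norm A + op_norm B"
  unfolding op_norm_def matrix_vector_mult_add_rdistrib
  by (intro onorm_triangle matrix_vector_mul_bounded_linear)

lemma op_norm_mult: "op_norm (A ** B) \<le> op_norm A * op_norm B"
  unfolding op_norm_def
  using onorm_compose[OF matrix_vector_mul_bounded_linear matrix_vector_mul_bounded_linear, of A B]
  by (simp add: o_def matrix_vector_mul_assoc)

text \<open>Completing the square: the A-form is nonnegative at \<open>s *\<^sub>R x - y\<close>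
  with \<open>y\<close> the preimage of \<open>x\<close> under A, and \<open>x \<bullet> y\<close>
  is at most \<open>s * (x \<bullet> x)\<close>. No square root of A and no spectral theorem is
  involved.\<close>

lemma inner_self_le_pos_def:
  assumes A: "A \<in> pos_def_matrices"
  shows "x \<bullet> x \<le> op_norm (matrix_inv A) * (x \<bullet> (A *v x))"
proof (cases "x = 0")
  case False
  define s where "s = op_norm (matrix_inv A)"
  define y where "y = matrix_inv A *v x"
  have y: "A *v y = x" using pos_def_mult_inv[OF A] by (simp add: y_def)
  have "0 < x \<bullet> (matrix_inv A *v x)"
    using False matrix_inv_pos_def[OF A] by (rule pos_def_pos[rotated])
  also have *: "\<dots> \<le> s * (x \<bullet> x)" unfolding s_def by (rule inner_mult_le_op_norm)
  finally have "s > 0" using False by (metis inner_gt_zero_iff zero_less_mult_pos2)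
  have "0 \<le> (s *\<^sub>R x - y) \<bullet> (A *v (s *\<^sub>R x - y))" by (rule pos_def_nonneg[OF A])
  also have "\<dots> = s * (s * (x \<bullet> (A *v x))) - 2 * s * (x \<bullet> x) + x \<bullet> y"
    using pos_def_inner_swap[OF A, of y x]
    by (simp add: matrix_vector_mult_diff_distrib matrix_vector_mult_scaleR inner_diff_left
        inner_diff_right y algebra_simps inner_commute)
  finally have "s * (x \<bullet> x) \<le> s * (s * (x \<bullet> (A *v x)))"
    using * by (simp add: y_def)
  then show ?thesis using \<open>s > 0\<close> by (simp add: s_def)
qed simp

section \<open>Williamson's theorem\<close>

text \<open>The first-order condition at an extremum, in a form that avoids differentiating a
  quotient of quadratic forms. If b were nonzero, a small step against its sign would make the
  linear term dominate.\<close>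

lemma quadratic_nonneg_imp_linear_zero:
  fixes b c :: real
  assumes "\<And>t. 0 \<le> t * b + t\<^sup>2 * c"
  shows "b = 0"
proof (rule ccontr)
  assume "b \<noteq> 0"
  define k where "k = \<bar>c\<bar> + 1"
  have k: "k > 0" "c < k" by (auto simp: k_def)
  have "0 \<le> (- b / k) * b + (- b / k)\<^sup>2 * c" by (rule assms)
  also have "\<dots> = (b / k)\<^sup>2 * (c - k)"
    using k by (simp add: field_simps power2_eq_square)
  also have "\<dots> < 0"
    using k \<open>b \<noteq> 0\<close> by (intro mult_pos_neg) auto
  finally show False by simp
qed

text \<open>
  Symplectic pairs for \<open>A\<close> are split off one at a time. The relations \<open>A u = d J v\<close>,
  \<open>A v = - d J u\<close> make the \<open>A\<close>-orthogonal complement of the pairs found so far coincide with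
  the symplectic complement, so it is invariant under \<open>A\<^sup>-\<^sup>1 J\<close>. Taking the next pair where the
  quotient \<open>Jx \<bullet> A\<^sup>-\<^sup>1 Jx / x \<bullet> Ax\<close> is maximal yields increasing \<open>d\<close>.
\<close>

lemma next_symplectic_pair:
  fixes A :: "real^('n::finite + 'n)^('n + 'n)"
  assumes A: "A \<in> pos_def_matrices"
    and W: "subspace W" "W \<noteq> {0}"
    and inv: "\<And>x. x \<in> W \<Longrightarrow> matrix_inv A *v (symplectic_J *v x) \<in> W"
  obtains u v d where "u \<in> W" "v \<in> W" "0 < d" "A *v u = d *\<^sub>R (symplectic_J *v v)"
    "A *v v = - d *\<^sub>R (symplectic_J *v u)" "u \<bullet> (symplectic_J *v v) = 1"
    "\<And>x. x \<in> W \<Longrightarrow> d\<^sup>2 * ((symplectic_J *v x) \<bullet> (matrix_inv A *v (symplectic_J *v x))) \<le> x \<bullet> (A *v x)"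
proof -
  let ?J = "symplectic_J :: real^('n + 'n)^('n + 'n)"
  \<comment> \<open>\<open>T\<close> is skew for the inner product given by A, and
    \<open>q x\<close> is the squared A-length of \<open>T x\<close>. Hence \<open>q x / r x\<close>
    is the Rayleigh quotient of minus the square of \<open>T\<close>, and a maximizer on
    \<open>W\<close> should be an eigenvector.\<close>
  define T where "T x = matrix_inv A *v (?J *v x)" for x
  define q where "q x = (?J *v x) \<bullet> (matrix_inv A *v (?J *v x))" for x
  define r where "r x = x \<bullet> (A *v x)" for x
  have AT: "A *v T x = ?J *v x" for x
    by (simp add: T_def pos_def_mult_inv[OF A])
  have lin: "linear T" unfolding T_def
    by (intro linearI) (simp_all add: matrix_vector_right_distrib matrix_vector_mult_scaleR)
  have q_eq: "q x = T x \<bullet> (?J *v x)" for x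
    by (simp add: q_def T_def inner_commute)
  have swapT: "T x \<bullet> (?J *v y) = T y \<bullet> (?J *v x)" for x y
    by (metis AT A pos_def_inner_swap)
  have qpos: "0 < q x" if "x \<noteq> 0" for x
    unfolding q_def using that by (intro pos_def_pos matrix_inv_pos_def A) simp
  have rpos: "0 < r x" if "x \<noteq> 0" for x
    unfolding r_def using that A by (simp add: pos_def_pos)
  have q_scale: "q (c *\<^sub>R x) = c\<^sup>2 * q x" and r_scale: "r (c *\<^sub>R x) = c\<^sup>2 * r x" for c x
    by (simp_all add: q_def r_def matrix_vector_mult_scaleR power2_eq_square)
  have "compact (W \<inter> sphere 0 1)"
    using closed_subspace[OF W(1)] by (metis closed_Int_compact compact_sphere)
  moreover obtain z where "z \<in> W" "z \<noteq> 0"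
    using W subspace_0 by blast
  then have "(1 / norm z) *\<^sub>R z \<in> W \<inter> sphere 0 1"
    using W(1) by (simp add: subspace_scale)
  then have "W \<inter> sphere 0 1 \<noteq> {}" by blast
  moreover have "continuous_on (W \<inter> sphere 0 1) (\<lambda>x. q x / r x)"
  proof (intro continuous_intros)
    show "continuous_on (W \<inter> sphere 0 1) q" "continuous_on (W \<inter> sphere 0 1) r"
      unfolding q_def r_def
      by (intro continuous_intros bounded_linear.continuous_on[OF matrix_vector_mul_bounded_linear])+
    show "\<forall>x\<in>W \<inter> sphere 0 1. r x \<noteq> 0"
      using rpos by (metis IntD2 less_irrefl norm_zero mem_sphere_0 zero_neq_one)
  qed
  ultimately obtain p where p: "p \<in> W \<inter> sphere 0 1"
    and max: "\<And>x. x \<in> W \<inter> sphere 0 1 \<Longrightarrow> q x / r x \<le> q p / r p"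
    by (blast dest: continuous_attains_sup)
  have "p \<noteq> 0" "p \<in> W" using p by auto
  define l where "l = q p / r p"
  have "l > 0" using qpos rpos \<open>p \<noteq> 0\<close> by (simp add: l_def)
  have bound: "q x \<le> l * r x" if "x \<in> W" for x
  proof (cases "x = 0")
    case True
    then show ?thesis by (simp add: q_def r_def)
  next
    case False
    define y where "y = (1 / norm x) *\<^sub>R x"
    have "q y / r y \<le> l"
      unfolding l_def using that W(1) False by (intro max) (simp add: y_def subspace_scale)
    then have "q x / r x \<le> l"
      using False by (simp add: y_def q_scale r_scale)
    then show ?thesis using rpos[OF False] by (simp add: field_simps)
  qed
  have TTp: "T (T p) = - l *\<^sub>R p"
  proof -
    \<comment> \<open>The residual of the eigenvalue equation is itself an admissible direction,
      because \<open>W\<close> is invariant. Stationarity at \<open>p\<close> in the direction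
      \<open>h\<close> says precisely that \<open>r h = 0\<close>.\<close>
    define h where "h = T (T p) + l *\<^sub>R p"
    have "h \<in> W"
      unfolding h_def using \<open>p \<in> W\<close> inv W(1) by (simp add: T_def subspace_add subspace_scale)
    have "0 \<le> t * (2 * (l * (h \<bullet> (A *v p)) - T p \<bullet> (?J *v h))) + t\<^sup>2 * (l * r h - q h)" for t
    proof -
      have "p + t *\<^sub>R h \<in> W"
        using \<open>p \<in> W\<close> \<open>h \<in> W\<close> W(1) by (simp add: subspace_add subspace_scale)
      then have "q (p + t *\<^sub>R h) \<le> l * r (p + t *\<^sub>R h)" by (rule bound)
      moreover have "r (p + t *\<^sub>R h) = r p + 2 * t * (h \<bullet> (A *v p)) + t\<^sup>2 * r h"
        using pos_def_inner_swap[OF A, of p h]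
        by (simp add: r_def matrix_vector_right_distrib matrix_vector_mult_scaleR inner_add_left
            inner_add_right power2_eq_square algebra_simps)
      moreover have "q (p + t *\<^sub>R h) = q p + 2 * t * (T p \<bullet> (?J *v h)) + t\<^sup>2 * q h"
        using swapT[of p h]
        by (simp add: q_eq linear_add[OF lin] linear_scale[OF lin] matrix_vector_right_distrib
            matrix_vector_mult_scaleR inner_add_left inner_add_right power2_eq_square algebra_simps)
      moreover have "q p = l * r p"
        using rpos[OF \<open>p \<noteq> 0\<close>] by (simp add: l_def)
      ultimately show ?thesis by (simp add: algebra_simps)
    qed
    then have "l * (h \<bullet> (A *v p)) = T p \<bullet> (?J *v h)"
      using quadratic_nonneg_imp_linear_zero by fastforce
    moreover have "T p \<bullet> (?J *v h) = - (h \<bullet> (A *v T (T p)))"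
      unfolding AT by (rule inner_symplectic_J_swap)
    ultimately have "r h = 0"
      by (simp add: r_def h_def[symmetric] inner_add_right matrix_vector_right_distrib
          matrix_vector_mult_scaleR) (simp add: h_def matrix_vector_right_distrib
          matrix_vector_mult_scaleR inner_add_right inner_add_left)
    then have "h = 0" using rpos[of h] by force
    then show ?thesis by (simp add: h_def add_eq_0_iff)
  qed
  \<comment> \<open>On the plane of \<open>p\<close> and \<open>T p\<close>, the map
    \<open>T\<close> is a rotation by a right angle times \<open>s\<close>. The second vector is
    thus \<open>T u\<close> divided by \<open>- s\<close>, and \<open>c\<close> is chosen to make
    the symplectic form of the pair equal to 1.\<close>
  define s where "s = sqrt l"
  have s: "s > 0" "s * s = l" using \<open>l > 0\<close> by (simp_all add: s_def)
  define c where "c = 1 / sqrt (s * r p)"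
  have c: "c * c * (s * r p) = 1"
    using s(1) rpos[OF \<open>p \<noteq> 0\<close>] by (simp add: c_def)
  define u where "u = c *\<^sub>R p"
  define v where "v = (- c / s) *\<^sub>R T p"
  define d where "d = 1 / s"
  show thesis
  proof
    show "u \<in> W" "v \<in> W"
      using \<open>p \<in> W\<close> inv W(1) by (simp_all add: u_def v_def T_def subspace_scale subspace_neg)
    show "0 < d" using s by (simp add: d_def)
    have "?J *v T p = A *v (- l *\<^sub>R p)" using TTp AT by metis
    then have JTp: "?J *v T p = (- (s * s)) *\<^sub>R (A *v p)"
      by (simp only: s(2) matrix_vector_mult_scaleR)
    show "A *v u = d *\<^sub>R (?J *v v)"
      using s(1) by (simp add: u_def v_def d_def matrix_vector_mult_scaleR linear_neg[OF matrix_vector_mul_linear] JTp)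
    show "A *v v = - d *\<^sub>R (?J *v u)"
      by (simp add: u_def v_def d_def matrix_vector_mult_scaleR linear_neg[OF matrix_vector_mul_linear] AT)
    have "u \<bullet> (?J *v v) = c * c * (s * r p)"
      using s(1) by (simp add: u_def v_def matrix_vector_mult_scaleR linear_neg[OF matrix_vector_mul_linear] JTp r_def)
    with c show "u \<bullet> (?J *v v) = 1" by simp
    fix x assume "x \<in> W"
    then have "d\<^sup>2 * q x \<le> d\<^sup>2 * (l * r x)"
      by (intro mult_left_mono bound) auto
    also have "\<dots> = r x" using s by (simp add: d_def power2_eq_square s(2)[symmetric])
    finally show "d\<^sup>2 * ((?J *v x) \<bullet> (matrix_inv A *v (?J *v x))) \<le> x \<bullet> (A *v x)"
      by (simp add: q_def r_def)
  qed
qed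

text \<open>Indices are added in increasing order. The last conjunct serves the induction: it
  remembers the maximality of earlier choices on what remains of the space, and evaluated at the
  next vector it gives the ordering of \<open>d\<close>. It survives each step because the
  complement only shrinks. Orthogonality is recorded for A only; that for J follows from the pair
  relations.\<close>

lemma symplectic_pairs_exist:
  fixes A :: "real^('n::{finite,linorder} + 'n)^('n + 'n)" and S :: "'n set"
  assumes A: "A \<in> pos_def_matrices"
  shows "\<exists>u v d. (\<forall>i\<in>S. 0 < d i \<and> A *v u i = d i *\<^sub>R (symplectic_J *v v i)
      \<and> A *v v i = - d i *\<^sub>R (symplectic_J *v u i) \<and> u i \<bullet> (symplectic_J *v v i) = 1)
    \<and> (\<forall>i\<in>S. \<forall>j\<in>S. i \<noteq> j \<longrightarrow> u i \<bullet> (A *v u j) = 0 \<and> u i \<bullet> (A *v v j) = 0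
        \<and> v i \<bullet> (A *v u j) = 0 \<and> v i \<bullet> (A *v v j) = 0)
    \<and> (\<forall>i\<in>S. \<forall>j\<in>S. i \<le> j \<longrightarrow> d i \<le> d j)
    \<and> (\<forall>i\<in>S. \<forall>x. (\<forall>j\<in>S. x \<bullet> (A *v u j) = 0 \<and> x \<bullet> (A *v v j) = 0) \<longrightarrow>
        (d i)\<^sup>2 * ((symplectic_J *v x) \<bullet> (matrix_inv A *v (symplectic_J *v x))) \<le> x \<bullet> (A *v x))"
    (is "\<exists>u v d. ?P S u v d")
proof (induction S rule: finite_linorder_max_induct[OF finite])
  case 1
  then show ?case by simp
next
  case (2 b S)
  let ?J = "symplectic_J :: real^('n + 'n)^('n + 'n)"
  from 2(3) obtain u v d where P: "?P S u v d"
    by (elim exE) (rule that)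
  note P1 = P[THEN conjunct1] and P2 = P[THEN conjunct2, THEN conjunct1]
    and P3 = P[THEN conjunct2, THEN conjunct2, THEN conjunct1]
    and P4 = P[THEN conjunct2, THEN conjunct2, THEN conjunct2]
  define W where "W = {x. \<forall>j\<in>S. x \<bullet> (A *v u j) = 0 \<and> x \<bullet> (A *v v j) = 0}"
  \<comment> \<open>\<open>W\<close> is the Euclidean orthogonal complement of \<open>R\<close>,
    which has at most 2 \<open>card S\<close> < 2n elements; so there is room for another
    pair.\<close>
  define R where "R = (\<lambda>j. A *v u j) ` S \<union> (\<lambda>j. A *v v j) ` S"
  have "subspace W"
    by (auto simp: W_def subspace_def inner_add_left)
  have "b \<notin> S" using 2(2) by auto
  then have "card S < CARD('n)"
    by (metis UNIV_I finite psubsetI psubset_card_mono subset_UNIV)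
  have "dim R \<le> card R" by (intro dim_le_card') (auto simp: R_def)
  also have "\<dots> \<le> card S + card S"
    unfolding R_def by (intro card_Un_le[THEN order_trans] add_mono card_image_le) auto
  also have "\<dots> < DIM(real^('n + 'n))" using \<open>card S < CARD('n)\<close> by simp
  finally have "dim R < DIM(real^('n + 'n))" .
  then obtain z where z: "z \<noteq> 0" "\<And>y. y \<in> span R \<Longrightarrow> orthogonal z y"
    using orthogonal_to_subspace_exists by blast
  have "z \<in> W"
    using z(2)[OF span_base] by (auto simp: W_def R_def orthogonal_def)
  with z(1) have "W \<noteq> {0}" by blast
  have inv: "matrix_inv A *v (?J *v x) \<in> W" if "x \<in> W" for x
  proof -
    have "x \<bullet> (?J *v u j) = 0" "x \<bullet> (?J *v v j) = 0" if "j \<in> S" for j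
    proof -
      have "x \<bullet> (A *v u j) = 0" "x \<bullet> (A *v v j) = 0" using \<open>x \<in> W\<close> that by (simp_all add: W_def)
      moreover have "0 < d j" "A *v u j = d j *\<^sub>R (?J *v v j)" "A *v v j = - d j *\<^sub>R (?J *v u j)"
        using P1 that by simp_all
      ultimately show "x \<bullet> (?J *v u j) = 0" "x \<bullet> (?J *v v j) = 0" by simp_all
    qed
    then have "u j \<bullet> (?J *v x) = 0" "v j \<bullet> (?J *v x) = 0" if "j \<in> S" for j
      using inner_symplectic_J_swap[of _ x] that by simp_all
    moreover have "(matrix_inv A *v (?J *v x)) \<bullet> (A *v y) = y \<bullet> (?J *v x)" for y
      using pos_def_inner_swap[OF A] pos_def_mult_inv(1)[OF A] by metis
    ultimately show ?thesis by (simp add: W_def)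
  qed
  obtain u' v' d' where N: "u' \<in> W" "v' \<in> W" "0 < d'" "A *v u' = d' *\<^sub>R (?J *v v')"
    "A *v v' = - d' *\<^sub>R (?J *v u')" "u' \<bullet> (?J *v v') = 1"
    "\<And>x. x \<in> W \<Longrightarrow> d'\<^sup>2 * ((?J *v x) \<bullet> (matrix_inv A *v (?J *v x))) \<le> x \<bullet> (A *v x)"
    using next_symplectic_pair[OF A \<open>subspace W\<close> \<open>W \<noteq> {0}\<close> inv] by blast
  have le: "d i \<le> d'" if "i \<in> S" for i
  proof -
    \<comment> \<open>For a normalized pair the A-energy of \<open>u'\<close> is \<open>d'\<close>
      and this dual energy is \<open>1 / d'\<close>, so the recorded bound compares the squares of
      \<open>d i\<close> and \<open>d'\<close>.\<close>
    let ?q = "(?J *v u') \<bullet> (matrix_inv A *v (?J *v u'))"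
    have "(d i)\<^sup>2 * ?q \<le> u' \<bullet> (A *v u')"
      using P4 N(1) that by (simp add: W_def)
    moreover have "u' \<bullet> (A *v u') = d'" by (simp add: N)
    moreover have "?q = 1 / d'"
    proof -
      have "?J *v u' = A *v ((- 1 / d') *\<^sub>R v')"
        using N(3) by (simp add: matrix_vector_mult_scaleR linear_neg[OF matrix_vector_mul_linear] N(5))
      then have "matrix_inv A *v (?J *v u') = (- 1 / d') *\<^sub>R v'"
        using pos_def_mult_inv(2)[OF A] by metis
      then show ?thesis
        using N(6) inner_symplectic_J_swap[of u' v'] by (simp add: inner_commute)
    qed
    ultimately have "(d i)\<^sup>2 / d' \<le> d'" by simp
    then have "(d i)\<^sup>2 \<le> d'\<^sup>2"
      using N(3) by (simp add: pos_divide_le_eq power2_eq_square)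
    then show ?thesis using N(3) by (rule power2_le_imp_le[OF _ less_imp_le])
  qed
  have W0: "u' \<bullet> (A *v u j) = 0" "u' \<bullet> (A *v v j) = 0" "v' \<bullet> (A *v u j) = 0" "v' \<bullet> (A *v v j) = 0"
    "u j \<bullet> (A *v u') = 0" "v j \<bullet> (A *v u') = 0" "u j \<bullet> (A *v v') = 0" "v j \<bullet> (A *v v') = 0"
    if "j \<in> S" for j
    using N(1,2) that unfolding W_def
    by (simp_all add: pos_def_inner_swap[OF A, of _ u'] pos_def_inner_swap[OF A, of _ v'])
  have ne: "j \<noteq> b" if "j \<in> S" for j using that \<open>b \<notin> S\<close> by blast
  have lt: "j < b" if "j \<in> S" for j using that 2(2) by simp
  have pairs: "?P (insert b S) (u(b := u')) (v(b := v')) (d(b := d'))"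
  proof (intro conjI)
    show "\<forall>i\<in>insert b S. \<forall>j\<in>insert b S. i \<le> j \<longrightarrow> (d(b := d')) i \<le> (d(b := d')) j"
      using P3 le lt ne by (auto simp: not_le[symmetric])
    show "\<forall>i\<in>insert b S. \<forall>x. (\<forall>j\<in>insert b S. x \<bullet> (A *v (u(b := u')) j) = 0 \<and> x \<bullet> (A *v (v(b := v')) j) = 0) \<longrightarrow>
        ((d(b := d')) i)\<^sup>2 * ((?J *v x) \<bullet> (matrix_inv A *v (?J *v x))) \<le> x \<bullet> (A *v x)"
    proof (intro ballI allI impI)
      fix i x assume i: "i \<in> insert b S"
        and *: "\<forall>j\<in>insert b S. x \<bullet> (A *v (u(b := u')) j) = 0 \<and> x \<bullet> (A *v (v(b := v')) j) = 0"
      have x: "\<forall>j\<in>S. x \<bullet> (A *v u j) = 0 \<and> x \<bullet> (A *v v j) = 0"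
        using * ne by fastforce
      then have "x \<in> W" by (simp add: W_def)
      show "((d(b := d')) i)\<^sup>2 * ((?J *v x) \<bullet> (matrix_inv A *v (?J *v x))) \<le> x \<bullet> (A *v x)"
        using i N(7)[OF \<open>x \<in> W\<close>] P4 x by (cases "i = b") auto
    qed
  qed (use P1 P2 N(3-6) W0 ne in auto)
  show ?case
    by (rule exI[where x = "u(b := u')"], rule exI[where x = "v(b := v')"],
        rule exI[where x = "d(b := d')"], rule pairs)
qed

theorem williamson_exists:
  fixes A :: "real^('n::{finite,linorder} + 'n)^('n + 'n)"
  assumes A: "A \<in> pos_def_matrices"
  shows "\<exists>d. williamson_form A d"
proof -
  let ?J = "symplectic_J :: real^('n + 'n)^('n + 'n)"
  obtain u v :: "'n \<Rightarrow> real^('n + 'n)" and d :: "'n \<Rightarrow> real" where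
    d: "\<And>i. 0 < d i" and Au: "\<And>i. A *v u i = d i *\<^sub>R (?J *v v i)"
    and Av: "\<And>i. A *v v i = - d i *\<^sub>R (?J *v u i)" and uv: "\<And>i. u i \<bullet> (?J *v v i) = 1"
    and orth: "\<And>i j. i \<noteq> j \<Longrightarrow> u i \<bullet> (A *v u j) = 0 \<and> u i \<bullet> (A *v v j) = 0
        \<and> v i \<bullet> (A *v u j) = 0 \<and> v i \<bullet> (A *v v j) = 0"
    and mono: "\<And>i j. i \<le> j \<Longrightarrow> d i \<le> d j"
    using symplectic_pairs_exist[OF A, of UNIV] unfolding ball_UNIV by metis
  have vu: "v i \<bullet> (?J *v u i) = - 1" for i
    using uv inner_symplectic_J_swap[of "v i" "u i"] by simp
  have d0: "d i \<noteq> 0" for i using d[of i] by simp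
  have orthJ: "u i \<bullet> (?J *v v j) = 0" "v i \<bullet> (?J *v u j) = 0" if "i \<noteq> j" for i j
    using orth[OF that] d0 by (auto simp: Au Av)
  \<comment> \<open>For distinct indices this comes from A-orthogonality, for equal ones from
    antisymmetry of J.\<close>
  have isotropic: "u i \<bullet> (?J *v u j) = 0" "v i \<bullet> (?J *v v j) = 0" for i j
    using orth[of i j] d0 by (cases "i = j"; simp add: Au Av)+
  define M :: "real^('n + 'n)^('n + 'n)" where
    "M = (\<chi> k l. case l of Inl j \<Rightarrow> u j $ k | Inr j \<Rightarrow> v j $ k)"
  have col: "column (Inl j) M = u j" "column (Inr j) M = v j" for j
    by (simp_all add: column_def M_def vec_eq_iff)
  have "transpose M ** ?J ** M = ?J"
  proof -
    have "(transpose M ** ?J ** M) $ k $ l = ?J $ k $ l" for k l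
      unfolding congruence_component
      by (cases k; cases l)
        (auto simp: col symplectic_J_def[THEN arg_cong, of "\<lambda>M. M $ _ $ _"] block_matrix_def mat_def uv vu orthJ isotropic)
    then show ?thesis by (simp add: vec_eq_iff)
  qed
  moreover have "transpose M ** A ** M = block_matrix (diag_matrix d) 0 0 (diag_matrix d)"
  proof -
    have "(transpose M ** A ** M) $ k $ l = block_matrix (diag_matrix d) 0 0 (diag_matrix d) $ k $ l" for k l
      unfolding congruence_component
      by (cases k; cases l)
        (auto simp: col block_matrix_def diag_matrix_def Au Av uv vu orthJ isotropic)
    then show ?thesis by (simp add: vec_eq_iff)
  qed
  ultimately have "williamson_form A d"
    using d mono by (auto simp: williamson_form_def symplectic_def mono_def)
  then show ?thesis by blast
qed

text \<open>Uniqueness is monotonicity applied in both directions with A compared to itself.\<close>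

lemma williamson_form_symplectic_eigenvalue:
  assumes "A \<in> pos_def_matrices"
  shows "williamson_form A (symplectic_eigenvalue A)"
proof -
  obtain d where d: "williamson_form A d"
    using williamson_exists[OF assms] by blast
  show ?thesis
    unfolding symplectic_eigenvalue_def
  proof (rule theI[of "williamson_form A", OF d])
    fix e assume "williamson_form A e"
    then show "e = d"
      using d williamson_form_mono[of A _ A] by (intro ext antisym) auto
  qed
qed

section \<open>Perturbation bounds\<close>

lemma williamson_form_scaleR:
  assumes "williamson_form A d" "0 < c"
  shows "williamson_form (c *\<^sub>R A) (\<lambda>j. c * d j)"
proof -
  obtain M where M: "symplectic M"
      "transpose M ** A ** M = block_matrix (diag_matrix d) 0 0 (diag_matrix d)"
    using assms by (auto simp: williamson_form_def)
  have "transpose M ** (c *\<^sub>R A) ** M = c *\<^sub>R (transpose M ** A ** M)"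
    by (simp add: matrix_scalar_ac scalar_matrix_assoc)
  also have "\<dots> = block_matrix (diag_matrix (\<lambda>j. c * d j)) 0 0 (diag_matrix (\<lambda>j. c * d j))"
    unfolding M(2) by (auto simp: vec_eq_iff block_matrix_def diag_matrix_def split: sum.split)
  finally show ?thesis
    using assms M(1) by (auto simp: williamson_form_def mono_def)
qed

lemma williamson_form_scaled_identity:
  assumes "0 < c"
  shows "williamson_form (c *\<^sub>R mat 1) (\<lambda>_. c)"
proof -
  have "williamson_form (mat 1) (\<lambda>_. 1)"
    unfolding williamson_form_def symplectic_def
  proof (intro conjI exI[of _ "mat 1"])
    have "mat 1 = block_matrix (diag_matrix (\<lambda>_. 1)) 0 0 (diag_matrix (\<lambda>_. 1 :: real))"
      by (auto simp: vec_eq_iff block_matrix_def diag_matrix_def mat_def split: sum.split)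
    then show "transpose (mat 1) ** mat 1 ** mat 1
        = block_matrix (diag_matrix (\<lambda>_. 1)) 0 0 (diag_matrix (\<lambda>_. 1 :: real))"
      by (simp add: transpose_mat)
  qed (auto simp: mono_def transpose_mat)
  from williamson_form_scaleR[OF this assms] show ?thesis by simp
qed

text \<open>A lies below the identity scaled by its norm, all of whose symplectic eigenvalues equal
  that norm. The basis vector \<open>x\<close> only serves to show that the scaling factor is
  positive.\<close>

lemma symplectic_eigenvalue_le_op_norm:
  fixes A :: "real^('n::{finite,linorder} + 'n)^('n + 'n)"
  assumes A: "A \<in> pos_def_matrices"
  shows "symplectic_eigenvalue A j \<le> op_norm A"
proof -
  have form: "williamson_form A (symplectic_eigenvalue A)"
    by (rule williamson_form_symplectic_eigenvalue[OF A])
  define x :: "real^('n + 'n)" where "x = axis (Inl j) 1"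
  have "0 < x \<bullet> (A *v x)"
    by (rule pos_def_pos[OF A]) (simp add: x_def)
  also have "\<dots> \<le> op_norm A * (x \<bullet> x)"
    by (rule inner_mult_le_op_norm)
  finally have "0 < op_norm A" by (simp add: x_def inner_axis)
  then show ?thesis
    using williamson_form_mono[OF form williamson_form_scaled_identity]
    by (simp add: scaleR_matrix_vector_assoc[symmetric] inner_mult_le_op_norm)
qed

text \<open>
  With \<open>\<delta> = \<parallel>B - A\<parallel>\<close> one has \<open>B \<le> A + \<delta> I \<le> (1 + \<delta> \<parallel>A\<^sup>-\<^sup>1\<parallel>) A\<close>, and symplectic eigenvalues are
  monotone and positively homogeneous.
\<close>

lemma symplectic_eigenvalue_diff_le:
  assumes A: "A \<in> pos_def_matrices" and B: "B \<in> pos_def_matrices"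
  shows "symplectic_eigenvalue B j - symplectic_eigenvalue A j \<le> condition_number A * op_norm (B - A)"
proof -
  define s where "s = op_norm (matrix_inv A) * op_norm (B - A)"
  have "s \<ge> 0" by (simp add: s_def op_norm_nonneg)
  have "x \<bullet> (B *v x) \<le> x \<bullet> (((1 + s) *\<^sub>R A) *v x)" for x
  proof -
    have "x \<bullet> (B *v x) = x \<bullet> (A *v x) + x \<bullet> ((B - A) *v x)"
      by (simp add: matrix_vector_mult_diff_rdistrib inner_diff_right)
    also have "x \<bullet> ((B - A) *v x) \<le> op_norm (B - A) * (x \<bullet> x)"
      by (rule inner_mult_le_op_norm)
    also have "\<dots> \<le> op_norm (B - A) * (op_norm (matrix_inv A) * (x \<bullet> (A *v x)))"
      by (intro mult_left_mono inner_self_le_pos_def A op_norm_nonneg)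
    finally show ?thesis
      by (simp add: s_def scaleR_matrix_vector_assoc[symmetric] algebra_simps)
  qed
  moreover have "williamson_form ((1 + s) *\<^sub>R A) (\<lambda>j. (1 + s) * symplectic_eigenvalue A j)"
    using \<open>s \<ge> 0\<close> by (intro williamson_form_scaleR williamson_form_symplectic_eigenvalue A) simp
  ultimately have "symplectic_eigenvalue B j \<le> (1 + s) * symplectic_eigenvalue A j"
    using williamson_form_mono[OF williamson_form_symplectic_eigenvalue[OF B]] by blast
  moreover have "s * symplectic_eigenvalue A j \<le> s * op_norm A"
    using \<open>s \<ge> 0\<close> symplectic_eigenvalue_le_op_norm[OF A] by (intro mult_left_mono) auto
  ultimately show ?thesis by (simp add: s_def condition_number_def algebra_simps)
qed

section \<open>Continuity of the condition number along the segment\<close>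

text \<open>The resolvent identity; it converts a uniform bound on the inverses into a Lipschitz
  bound for inversion.\<close>

lemma matrix_inv_diff:
  fixes A B :: "real^'m^'m"
  assumes "invertible A" "invertible B"
  shows "matrix_inv A - matrix_inv B = matrix_inv A ** (B - A) ** matrix_inv B"
proof -
  have "matrix_inv A ** (B - A) ** matrix_inv B
      = matrix_inv A ** (B ** matrix_inv B) - (matrix_inv A ** A) ** matrix_inv B"
    by (simp add: matrix_eq matrix_vector_mul_assoc[symmetric] matrix_vector_mult_diff_rdistrib
        matrix_vector_mult_diff_distrib)
  then show ?thesis using assms by (simp add: matrix_inv_left matrix_inv_right)
qed

lemma segment_pos_def:
  assumes A: "A \<in> pos_def_matrices" and B: "B \<in> pos_def_matrices" and t: "t \<in> {0..1}"
  shows "A + t *\<^sub>R (B - A) \<in> pos_def_matrices"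
proof -
  have eq: "x \<bullet> ((A + t *\<^sub>R (B - A)) *v x) = (1 - t) * (x \<bullet> (A *v x)) + t * (x \<bullet> (B *v x))" for x
    by (simp add: matrix_vector_mult_add_rdistrib matrix_vector_mult_diff_rdistrib
        scaleR_matrix_vector_assoc[symmetric] inner_add_right inner_diff_right algebra_simps)
  have "0 < x \<bullet> ((A + t *\<^sub>R (B - A)) *v x)" if "x \<noteq> 0" for x
    using t pos_def_pos[OF A that] pos_def_pos[OF B that] unfolding eq
    by (cases "t = 0") (auto intro!: add_nonneg_pos)
  moreover have "transpose (A + t *\<^sub>R (B - A)) = A + t *\<^sub>R (B - A)"
    using A B by (auto simp: pos_def_matrices_def vec_eq_iff transpose_def)
  ultimately show ?thesis by (simp add: pos_def_matrices_def)
qed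

lemma op_norm_matrix_inv_le:
  assumes A: "A \<in> pos_def_matrices" and c: "0 < c" "\<And>x. c * (x \<bullet> x) \<le> x \<bullet> (A *v x)"
  shows "op_norm (matrix_inv A) \<le> 1 / c"
proof (rule op_norm_le)
  fix x
  define y where "y = matrix_inv A *v x"
  have "A *v y = x" using pos_def_mult_inv[OF A] by (simp add: y_def)
  then have "c * (norm y * norm y) \<le> y \<bullet> x"
    using c(2)[of y] by (simp add: dot_square_norm power2_eq_square)
  also have "\<dots> \<le> norm y * norm x" by (rule norm_cauchy_schwarz)
  finally have "c * norm y \<le> norm x"
    by (cases "y = 0") (auto simp: mult.left_commute)
  then show "norm (matrix_inv A *v x) \<le> 1 / c * norm x"
    using c(1) by (simp add: y_def field_simps)
qed (use c in simp)

lemma abs_op_norm_diff_le: "\<bar>op_norm A - op_norm B\<bar> \<le> op_norm (A - B)"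
  using op_norm_triangle[of "A - B" B] op_norm_triangle[of "B - A" A] op_norm_diff_commute[of A B]
  by simp

lemma pos_def_lower_bound:
  assumes "A \<in> pos_def_matrices"
  obtains c where "0 < c" "\<And>x. c * (x \<bullet> x) \<le> x \<bullet> (A *v x)"
proof
  \<comment> \<open>Adding 1 makes the denominator visibly positive; the constant need not be
    sharp.\<close>
  let ?s = "op_norm (matrix_inv A) + 1"
  have s: "?s > 0" using op_norm_nonneg[of "matrix_inv A"] by linarith
  then show "0 < 1 / ?s" by simp
  fix x
  have "x \<bullet> x \<le> ?s * (x \<bullet> (A *v x))"
    using inner_self_le_pos_def[OF assms, of x] pos_def_nonneg[OF assms, of x]
    by (simp add: distrib_right)
  then show "1 / ?s * (x \<bullet> x) \<le> x \<bullet> (A *v x)"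
    using s by (simp add: field_simps)
qed

lemma lipschitz_imp_continuous_on:
  fixes f :: "real \<Rightarrow> real"
  assumes "\<And>x y. x \<in> S \<Longrightarrow> y \<in> S \<Longrightarrow> \<bar>f x - f y\<bar> \<le> L * \<bar>x - y\<bar>" "0 \<le> L"
  shows "continuous_on S f"
  using assms by (intro lipschitz_on_continuous_on[of L] lipschitz_onI) (auto simp: dist_real_def)

text \<open>Both factors are Lipschitz in t. For the inverse, the smaller of the lower bounds of the
  quadratic forms of A and B passes to all convex combinations and bounds every inverse on the
  segment.\<close>

lemma continuous_on_condition_number_segment:
  fixes A B :: "real^'m^'m"
  assumes A: "A \<in> pos_def_matrices" and B: "B \<in> pos_def_matrices"
  shows "continuous_on {0..1} (\<lambda>t. condition_number (A + t *\<^sub>R (B - A)))"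
proof -
  define G where "G t = A + t *\<^sub>R (B - A)" for t
  define D where "D = op_norm (B - A)"
  have G: "G t \<in> pos_def_matrices" if "t \<in> {0..1}" for t
    using segment_pos_def[OF A B that] by (simp add: G_def)
  have GG: "op_norm (G t - G s) = D * \<bar>t - s\<bar>" for s t
  proof -
    have "G t - G s = (t - s) *\<^sub>R (B - A)" by (simp add: G_def algebra_simps)
    then show ?thesis by (simp add: op_norm_scaleR D_def)
  qed
  have "D \<ge> 0" by (simp add: D_def op_norm_nonneg)
  obtain a where a: "0 < a" "\<And>x. a * (x \<bullet> x) \<le> x \<bullet> (A *v x)"
    using pos_def_lower_bound[OF A] by blast
  obtain b where b: "0 < b" "\<And>x. b * (x \<bullet> x) \<le> x \<bullet> (B *v x)" using pos_def_lower_bound[OF B] by blast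
  define c where "c = min a b"
  have c: "c > 0" using a b by (simp add: c_def)
  have inv_le: "op_norm (matrix_inv (G t)) \<le> 1 / c" if t: "t \<in> {0..1}" for t
  proof (rule op_norm_matrix_inv_le[OF G[OF t] c])
    fix x :: "real^'m"
    have "c * (x \<bullet> x) \<le> a * (x \<bullet> x)" "c * (x \<bullet> x) \<le> b * (x \<bullet> x)"
      by (auto simp: c_def intro!: mult_right_mono)
    then have "c * (x \<bullet> x) \<le> x \<bullet> (A *v x)" "c * (x \<bullet> x) \<le> x \<bullet> (B *v x)"
      using a(2)[of x] b(2)[of x] by linarith+
    then have "(1 - t) * (c * (x \<bullet> x)) + t * (c * (x \<bullet> x)) \<le> (1 - t) * (x \<bullet> (A *v x)) + t * (x \<bullet> (B *v x))"
      using t by (intro add_mono mult_left_mono) auto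
    then show "c * (x \<bullet> x) \<le> x \<bullet> (G t *v x)"
      by (simp add: G_def matrix_vector_mult_add_rdistrib matrix_vector_mult_diff_rdistrib
        scaleR_matrix_vector_assoc[symmetric] inner_add_right inner_diff_right algebra_simps)
  qed
  have "continuous_on {0..1} (\<lambda>t. op_norm (G t))"
    using abs_op_norm_diff_le[of "G _" "G _"] GG \<open>D \<ge> 0\<close>
    by (intro lipschitz_imp_continuous_on[of _ _ D]) simp_all
  moreover have "continuous_on {0..1} (\<lambda>t. op_norm (matrix_inv (G t)))"
  proof (rule lipschitz_imp_continuous_on)
    fix s t :: real assume st: "s \<in> {0..1}" "t \<in> {0..1}"
    have "\<bar>op_norm (matrix_inv (G s)) - op_norm (matrix_inv (G t))\<bar>
        \<le> op_norm (matrix_inv (G s) - matrix_inv (G t))" by (rule abs_op_norm_diff_le)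
    also have "\<dots> = op_norm (matrix_inv (G s) ** (G t - G s) ** matrix_inv (G t))"
      using G st by (simp add: matrix_inv_diff pos_def_invertible)
    also have "\<dots> \<le> op_norm (matrix_inv (G s) ** (G t - G s)) * op_norm (matrix_inv (G t))"
      by (rule op_norm_mult)
    also have "\<dots> \<le> (op_norm (matrix_inv (G s)) * op_norm (G t - G s)) * op_norm (matrix_inv (G t))"
      by (intro mult_right_mono op_norm_mult op_norm_nonneg)
    also have "\<dots> \<le> (1 / c * op_norm (G t - G s)) * (1 / c)"
      using st c by (intro mult_mono inv_le order.refl op_norm_nonneg mult_nonneg_nonneg) auto
    finally show "\<bar>op_norm (matrix_inv (G s)) - op_norm (matrix_inv (G t))\<bar> \<le> 1 / c * D * (1 / c) * \<bar>s - t\<bar>"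
      by (simp add: GG abs_minus_commute)
  qed (use c \<open>D \<ge> 0\<close> in simp)
  ultimately show ?thesis
    unfolding condition_number_def G_def[symmetric] by (rule continuous_on_mult)
qed

section \<open>From the local estimate to the integral bound\<close>

text \<open>A Riemann sum argument in place of the fundamental theorem of calculus. Up to an error
  \<open>c\<close> per unit length the bound holds on short intervals by continuity of
  \<open>k\<close>, and it is additive over adjacent intervals, so Bolzano bisection extends it to
  the whole interval.\<close>

lemma diff_le_integral_of_local_bound:
  fixes f k :: "real \<Rightarrow> real"
  assumes k: "continuous_on {a..b} k" and "a \<le> b"
    and f: "\<And>s t. a \<le> s \<Longrightarrow> s \<le> t \<Longrightarrow> t \<le> b \<Longrightarrow> f t - f s \<le> k s * (t - s)"
  shows "f b - f a \<le> integral {a..b} k"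
proof (rule field_le_epsilon)
  fix e :: real assume "e > 0"
  \<comment> \<open>The 1 in the denominator covers \<open>a = b\<close> and still keeps the total
    error below \<open>e\<close>.\<close>
  define c where "c = e / (b - a + 1)"
  have "c > 0" using \<open>e > 0\<close> \<open>a \<le> b\<close> by (simp add: c_def)
  have int: "k integrable_on {s..t}" if "a \<le> s" "t \<le> b" for s t
    using that by (intro integrable_continuous_real continuous_on_subset[OF k]) auto
  have "a \<le> a \<and> b \<le> b \<longrightarrow> f b - f a \<le> integral {a..b} k + c * (b - a)"
  \<comment> \<open>The guard in \<open>P\<close> is needed because \<open>Bolzano\<close> asks for
    the local property on all short intervals around a point, including those that leave
    \<open>{a..b}\<close>.\<close>
  proof (rule Bolzano[OF \<open>a \<le> b\<close>,
        where P = "\<lambda>s t. a \<le> s \<and> t \<le> b \<longrightarrow> f t - f s \<le> integral {s..t} k + c * (t - s)"])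
    fix p q r
    assume *: "a \<le> p \<and> q \<le> b \<longrightarrow> f q - f p \<le> integral {p..q} k + c * (q - p)"
      "a \<le> q \<and> r \<le> b \<longrightarrow> f r - f q \<le> integral {q..r} k + c * (r - q)" "p \<le> q" "q \<le> r"
    show "a \<le> p \<and> r \<le> b \<longrightarrow> f r - f p \<le> integral {p..r} k + c * (r - p)"
    proof
      assume pr: "a \<le> p \<and> r \<le> b"
      then have "integral {p..q} k + integral {q..r} k = integral {p..r} k"
        using *(3,4) int by (intro Henstock_Kurzweil_Integration.integral_combine) auto
      then show "f r - f p \<le> integral {p..r} k + c * (r - p)"
        using * pr by (simp add: algebra_simps)
    qed
  next
    fix x assume x: "a \<le> x" "x \<le> b"
    then obtain \<delta> where \<delta>: "\<delta> > 0" "\<And>y. y \<in> {a..b} \<Longrightarrow> dist y x < \<delta> \<Longrightarrow> dist (k y) (k x) < c / 2"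
      using k[unfolded continuous_on_iff, rule_format, of x "c / 2"] \<open>c > 0\<close> by auto
    show "\<exists>d>0. \<forall>s t. s \<le> x \<and> x \<le> t \<and> t - s < d \<longrightarrow>
        (a \<le> s \<and> t \<le> b \<longrightarrow> f t - f s \<le> integral {s..t} k + c * (t - s))"
    proof (intro exI[of _ \<delta>] conjI allI impI \<delta>(1))
      fix s t assume st: "s \<le> x \<and> x \<le> t \<and> t - s < \<delta>" "a \<le> s \<and> t \<le> b"
      have near: "\<bar>k y - k x\<bar> < c / 2" if "y \<in> {s..t}" for y
        using \<delta>(2)[of y] that st by (auto simp: dist_real_def)
      \<comment> \<open>Both \<open>k s\<close> and the values of \<open>k\<close> under the
        integral stay within \<open>c / 2\<close> of \<open>k x\<close>, which costs at most
        \<open>c\<close> in total.\<close>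
      have "(k x - c / 2) * (t - s) = integral {s..t} (\<lambda>_. k x - c / 2)"
        using st by simp
      also have "\<dots> \<le> integral {s..t} k"
      proof (intro integral_le int)
        fix y assume "y \<in> {s..t}"
        then show "k x - c / 2 \<le> k y" using near[of y] by linarith
      qed (use st in auto)
      finally have "(k x - c / 2) * (t - s) \<le> integral {s..t} k" .
      moreover have "f t - f s \<le> k s * (t - s)" using f st by simp
      moreover have "k s * (t - s) \<le> (k x + c / 2) * (t - s)"
      proof (rule mult_right_mono)
        have "s \<in> {s..t}" using st by simp
        from near[OF this] show "k s \<le> k x + c / 2" by linarith
      qed (use st in simp)
      moreover have "(k x + c / 2) * (t - s) = (k x - c / 2) * (t - s) + c * (t - s)"
        by (simp add: field_simps)
      ultimately show "f t - f s \<le> integral {s..t} k + c * (t - s)"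
        by linarith
    qed
  qed
  moreover have "c * (b - a) \<le> e"
    using \<open>e > 0\<close> \<open>a \<le> b\<close> by (simp add: c_def field_simps)
  ultimately show "f b - f a \<le> integral {a..b} k + e" by simp
qed

lemma symplectic_eigenvalue_diff_le_integral:
  assumes A: "A \<in> pos_def_matrices" and B: "B \<in> pos_def_matrices"
  shows "symplectic_eigenvalue B j - symplectic_eigenvalue A j
    \<le> integral {0..1} (\<lambda>t. condition_number (A + t *\<^sub>R (B - A))) * op_norm (B - A)"
proof -
  define G where "G t = A + t *\<^sub>R (B - A)" for t
  define D where "D = op_norm (B - A)"
  have "symplectic_eigenvalue (G 1) j - symplectic_eigenvalue (G 0) j
      \<le> integral {0..1} (\<lambda>t. condition_number (G t) * D)"
  proof (rule diff_le_integral_of_local_bound)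
    show "continuous_on {0..1} (\<lambda>t. condition_number (G t) * D)"
      unfolding G_def by (intro continuous_intros continuous_on_condition_number_segment A B)
    fix s t :: real assume st: "0 \<le> s" "s \<le> t" "t \<le> 1"
    have "G t - G s = (t - s) *\<^sub>R (B - A)" by (simp add: G_def algebra_simps)
    then have "op_norm (G t - G s) = D * (t - s)" using st by (simp add: op_norm_scaleR D_def)
    moreover have "G s \<in> pos_def_matrices" "G t \<in> pos_def_matrices"
      using st by (auto simp: G_def intro!: segment_pos_def A B)
    ultimately show "symplectic_eigenvalue (G t) j - symplectic_eigenvalue (G s) j
        \<le> condition_number (G s) * D * (t - s)"
      using symplectic_eigenvalue_diff_le[of "G s" "G t" j] by (simp add: mult.assoc)
  qed simp
  then show ?thesis by (simp add: G_def D_def)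
qed

text \<open>Exchanging A and B runs the segment backwards; this makes the constant symmetric in A
  and B.\<close>

lemma has_integral_reflect_01:
  fixes f :: "real \<Rightarrow> real"
  assumes "(f has_integral I) {0..1}"
  shows "((\<lambda>t. f (1 - t)) has_integral I) {0..1}"
proof -
  have "(\<lambda>x::real. 1 - x) ` {0..1} = {0..1}"
    by (simp add: image_diff_atLeastAtMost)
  then show ?thesis
    using has_integral_affinity01[OF assms, of "-1" 1] by simp
qed

theorem theorem5p9:
  fixes A B :: "real^('n::{finite,linorder} + 'n)^('n + 'n)"
  assumes "A \<in> pos_def_matrices" and "B \<in> pos_def_matrices"
  shows "(MAX j. \<bar>symplectic_eigenvalue A j - symplectic_eigenvalue B j\<bar>)
    \<le> integral {0..1} (\<lambda>t. condition_number (A + t *\<^sub>R (B - A))) * op_norm (A - B)"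
proof -
  have "integral {0..1} (\<lambda>t. condition_number (B + t *\<^sub>R (A - B)))
      = integral {0..1} (\<lambda>t. condition_number (A + (1 - t) *\<^sub>R (B - A)))"
    by (simp add: algebra_simps)
  also have "\<dots> = integral {0..1} (\<lambda>t. condition_number (A + t *\<^sub>R (B - A)))"
    by (intro integral_unique has_integral_reflect_01 integrable_integral integrable_continuous_real
        continuous_on_condition_number_segment assms)
  finally have reverse: "integral {0..1} (\<lambda>t. condition_number (B + t *\<^sub>R (A - B)))
      = integral {0..1} (\<lambda>t. condition_number (A + t *\<^sub>R (B - A)))" .
  have "\<bar>symplectic_eigenvalue A j - symplectic_eigenvalue B j\<bar>
      \<le> integral {0..1} (\<lambda>t. condition_number (A + t *\<^sub>R (B - A))) * op_norm (A - B)" for j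
    using symplectic_eigenvalue_diff_le_integral[OF assms, of j]
      symplectic_eigenvalue_diff_le_integral[OF assms(2,1), of j]
    unfolding reverse op_norm_diff_commute[of B A] by (simp add: abs_le_iff)
  then show ?thesis by simp
qed

end
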